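(* Let $k\ge 1$ and $0\le b_0\le k$ be integers. Then, as formal power series in $q,z$, $$\chi_{k,2;b_0}(q,z)=\sum_{n=0}^{\infty}\ \sum_{\substack{m_1,\dots,m_k\ge 0\\ m_1+2m_2+\cdots+km_k=n}}\frac{q^{\frac12\left({}^t\mathbf m A^{(2)}\mathbf m-(\operatorname{diag}A^{(2)})\cdot\mathbf m\right)+\mathbf c^{(2)}_{b_0}\cdot\mathbf m}}{(q)_{m_1}\cdots(q)_{m_k}}\,z^n ,$$ where $\mathbf m={}^t(m_1,\dots,m_k)$, $A^{(2)}=(A^{(2)}_{ab})_{1\le a,b\le k}$ with $A^{(2)}_{ab}=2\min(a,b)$, $\operatorname{diag}A^{(2)}$ is the vector of diagonal entries of $A^{(2)}$, and $\mathbf c^{(2)}_{b_0}=(0,\dots,0,1,2,\dots,k-b_0)\in\mathbb Z^k$ (its $a$-th entry is $\max(a-b_0,0)$).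
   Context: A sequence $\mathbf a=(a_i)_{i\ge0}$ of integers with finitely many non-zero entries is $(k,2)$-admissible if $0\le a_i\le k$ and $a_i+a_{i+1}\le k$ for all $i\ge 0$. Let $C^{(k,2)}_{b_0}$ be the set of $(k,2)$-admissible sequences with $a_0\le b_0$. The character of $(k,2)$-admissible configurations is $$\chi_{k,2;b_0}(q,z)=\sum_{\mathbf a\in C^{(k,2)}_{b_0}}q^{\sum_{j\ge0}ja_j}z^{\sum_{j\ge0}a_j}.$$ Also $(q)_m=\prod_{j=1}^m(1-q^j)$. *)

theory Defs
  imports "HOL-Computational_Algebra.Formal_Power_Series" "HOL-Library.FuncSet"
begin

unbundle fps_syntax

text \<open>
  Power series in \<open>q, z\<close> have type \<open>rat fps fps\<close>: the inner variable is \<open>q\<close>, the outer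
  one is \<open>z\<close>, so the coefficient of \<open>q^e z^n\<close> in \<open>F\<close> is \<open>(F $ n) $ e\<close>.  Coefficients are
  taken in \<open>rat\<close> rather than \<open>int\<close> because division of \<open>fps\<close> needs an \<open>inverse\<close> on the
  coefficients.
\<close>

definition qvar :: "rat fps fps" where
  "qvar = fps_const fps_X"

definition zvar :: "rat fps fps" where
  "zvar = fps_X"

text \<open>
  The sum of a possibly infinite family is taken coefficientwise.  It is meaningful only for
  families in which every coefficient is nonzero for finitely many members only.  (The
  library topology on \<open>rat fps fps\<close> is \<open>z\<close>-adic with discrete coefficients, so it cannot
  be used to sum infinitely many terms \<open>q^e z^n\<close> with the same \<open>n\<close>.)
\<close>

definition formally_summable :: "('i \<Rightarrow> rat fps fps) \<Rightarrow> 'i set \<Rightarrow> bool" where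
  "formally_summable f I \<longleftrightarrow> (\<forall>n e. finite {i \<in> I. f i $ n $ e \<noteq> 0})"

definition formal_sum :: "('i \<Rightarrow> rat fps fps) \<Rightarrow> 'i set \<Rightarrow> rat fps fps" where
  "formal_sum f I =
     Abs_fps (\<lambda>n. Abs_fps (\<lambda>e. \<Sum>i\<in>{i \<in> I. f i $ n $ e \<noteq> 0}. f i $ n $ e))"

text \<open>The bound \<open>0 \<le> a i\<close> is built into the type \<open>nat\<close>.\<close>

definition admissible2 :: "nat \<Rightarrow> (nat \<Rightarrow> nat) \<Rightarrow> bool" where
  "admissible2 k a \<longleftrightarrow>
     finite {i. a i \<noteq> 0} \<and> (\<forall>i. a i \<le> k) \<and> (\<forall>i. a i + a (i + 1) \<le> k)"

definition configs2 :: "nat \<Rightarrow> nat \<Rightarrow> (nat \<Rightarrow> nat) set" where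
  "configs2 k b0 = {a. admissible2 k a \<and> a 0 \<le> b0}"

definition qdegree :: "(nat \<Rightarrow> nat) \<Rightarrow> nat" where
  "qdegree a = (\<Sum>j | a j \<noteq> 0. j * a j)"

definition zdegree :: "(nat \<Rightarrow> nat) \<Rightarrow> nat" where
  "zdegree a = (\<Sum>j | a j \<noteq> 0. a j)"

definition character2 :: "nat \<Rightarrow> nat \<Rightarrow> rat fps fps" where
  "character2 k b0 = formal_sum (\<lambda>a. qvar ^ qdegree a * zvar ^ zdegree a) (configs2 k b0)"

text \<open>The constant coefficient is \<open>1\<close>, so dividing by \<open>qpoch m\<close> in \<open>rat fps\<close> is exact.\<close>

definition qpoch :: "nat \<Rightarrow> rat fps" where
  "qpoch m = (\<Prod>j=1..m. 1 - fps_X ^ j)"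

definition A2 :: "nat \<Rightarrow> nat \<Rightarrow> int" where
  "A2 a b = 2 * int (min a b)"

definition c2 :: "nat \<Rightarrow> nat \<Rightarrow> int" where
  "c2 b0 a = max (int a - int b0) 0"

text \<open>
  Vectors \<open>(m 1, \<dots>, m k)\<close> are functions on \<open>{1..k}\<close>.  Neither \<open>div\<close> nor \<open>nat\<close>
  loses anything here, see \<open>int_fermionic_exponent\<close>.
\<close>

definition fermionic_exponent :: "nat \<Rightarrow> nat \<Rightarrow> (nat \<Rightarrow> nat) \<Rightarrow> nat" where
  "fermionic_exponent k b0 m = nat (
     ((\<Sum>a=1..k. \<Sum>b=1..k. int (m a) * A2 a b * int (m b)) - (\<Sum>a=1..k. A2 a a * int (m a))) div 2
     + (\<Sum>a=1..k. c2 b0 a * int (m a)))"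

text \<open>
  Functions are made \<open>undefined\<close> outside \<open>{1..k}\<close> so that each vector is counted once.
\<close>

definition weighted_vectors :: "nat \<Rightarrow> nat \<Rightarrow> (nat \<Rightarrow> nat) set" where
  "weighted_vectors k n = {m \<in> {1..k} \<rightarrow>\<^sub>E UNIV. (\<Sum>a=1..k. a * m a) = n}"

lemma int_fermionic_exponent:
  "2 * int (fermionic_exponent k b0 m) =
     ((\<Sum>a=1..k. \<Sum>b=1..k. int (m a) * A2 a b * int (m b)) - (\<Sum>a=1..k. A2 a a * int (m a)))
     + 2 * (\<Sum>a=1..k. c2 b0 a * int (m a))"
proof -
  let ?Q = "(\<Sum>a=1..k. \<Sum>b=1..k. int (m a) * A2 a b * int (m b))"
  let ?D = "(\<Sum>a=1..k. A2 a a * int (m a))"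
  let ?C = "(\<Sum>a=1..k. c2 b0 a * int (m a))"
  have "?D \<le> ?Q"
  proof (rule sum_mono)
    fix a assume a: "a \<in> {1..k}"
    have "int (m a) \<le> int (m a) * int (m a)"
      by (cases "m a") auto
    then have "A2 a a * int (m a) \<le> A2 a a * (int (m a) * int (m a))"
      by (intro mult_left_mono) (auto simp: A2_def)
    also have "\<dots> = int (m a) * A2 a a * int (m a)" by (simp add: mult_ac)
    also have "\<dots> \<le> (\<Sum>b=1..k. int (m a) * A2 a b * int (m b))"
      using a by (intro member_le_sum) (auto simp: A2_def)
    finally show "A2 a a * int (m a) \<le> (\<Sum>b=1..k. int (m a) * A2 a b * int (m b))" .
  qed
  moreover have "even (?Q - ?D)"
    by (intro dvd_diff dvd_sum) (auto simp: A2_def)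
  moreover have "0 \<le> ?C" by (intro sum_nonneg) (auto simp: c2_def)
  ultimately show ?thesis
    unfolding fermionic_exponent_def by (auto elim!: evenE)
qed

lemma finite_weighted_vectors: "finite (weighted_vectors k n)"
proof (rule finite_subset)
  show "weighted_vectors k n \<subseteq> {1..k} \<rightarrow>\<^sub>E {..n}"
  proof
    fix m assume m: "m \<in> weighted_vectors k n"
    have "m a \<le> n" if a: "a \<in> {1..k}" for a
    proof -
      have "m a \<le> a * m a" using a by simp
      also have "\<dots> \<le> (\<Sum>a=1..k. a * m a)" using a by (intro member_le_sum) auto
      finally show ?thesis using m by (simp add: weighted_vectors_def)
    qed
    then show "m \<in> {1..k} \<rightarrow>\<^sub>E {..n}" using m by (auto simp: weighted_vectors_def PiE_def)
  qed
qed (auto intro: finite_PiE)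

lemma monomial_nth:
  "(qvar ^ i * zvar ^ j) $ n $ e = (if n = j \<and> e = i then 1 else 0)"
  unfolding qvar_def zvar_def
  by (auto simp: fps_const_power fps_X_power_nth)

lemma formally_summable_character2:
  "formally_summable (\<lambda>a. qvar ^ qdegree a * zvar ^ zdegree a) (configs2 k b0)"
  unfolding formally_summable_def
proof (intro allI)
  fix n e :: nat
  let ?S = "{a. \<forall>i. (i \<in> {..e} \<longrightarrow> a i \<in> {..k}) \<and> (i \<notin> {..e} \<longrightarrow> a i = (0::nat))}"
  have "{a \<in> configs2 k b0. (qvar ^ qdegree a * zvar ^ zdegree a) $ n $ e \<noteq> 0} \<subseteq> ?S"
  proof
    fix a assume "a \<in> {a \<in> configs2 k b0. (qvar ^ qdegree a * zvar ^ zdegree a) $ n $ e \<noteq> 0}"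
    then have fin: "finite {i. a i \<noteq> 0}" and le: "\<And>i. a i \<le> k" and e: "e = qdegree a"
      by (auto simp: configs2_def admissible2_def monomial_nth split: if_splits)
    have "i \<le> e" if "a i \<noteq> 0" for i
    proof -
      have "i \<le> i * a i" using that by simp
      also have "\<dots> \<le> qdegree a"
        unfolding qdegree_def using that fin by (intro member_le_sum) auto
      finally show ?thesis using e by simp
    qed
    then show "a \<in> ?S" using le by auto
  qed
  moreover have "finite ?S" by (rule finite_set_of_finite_funs) auto
  ultimately show "finite {a \<in> configs2 k b0. (qvar ^ qdegree a * zvar ^ zdegree a) $ n $ e \<noteq> 0}"
    by (rule finite_subset)
qed

end

theory Submission
  imports Defs
begin

text \<open>
  Let \<open>G\<^sub>k\<^sub>,\<^sub>b(z)\<close> be either side of the identity.  Both sides satisfy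
  \<open>G\<^sub>k\<^sub>,\<^sub>0(z) = G\<^sub>k\<^sub>,\<^sub>k(qz)\<close> and \<open>G\<^sub>k\<^sub>,\<^sub>b(z) - G\<^sub>k\<^sub>,\<^sub>b\<^sub>-\<^sub>1(z) = z\<^sup>b G\<^sub>k\<^sub>,\<^sub>k\<^sub>-\<^sub>b(qz)\<close> for
  \<open>1 \<le> b \<le> k\<close>, and these relations together with the value \<open>1\<close> at \<open>z = 0\<close> determine
  the family.  For the character the relations come from splitting off \<open>a\<^sub>0\<close>.  For the
  fermionic sum they follow by induction on \<open>k\<close> from summing over \<open>p = m\<^sub>k\<close> last:
  \<open>G\<^sub>k\<^sub>,\<^sub>b(z)\<close> is the sum over \<open>p\<close> of \<open>z\<^sup>k\<^sup>p q\<^sup>k\<^sup>p\<^sup>p\<^sup>-\<^sup>b\<^sup>p / (q)\<^sub>p\<close> times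
  \<open>G\<^sub>k\<^sub>-\<^sub>1\<^sub>,\<^sub>c(q\<^sup>2\<^sup>p z)\<close>, where \<open>c = min b (k - 1)\<close>.
\<close>

section \<open>Splitting the last variable off the fermionic sum\<close>

lemma qpoch_nth_0: "qpoch m $ 0 = 1"
  by (induction m) (auto simp: qpoch_def fps_X_power_nth)

lemma inverse_qpoch_Suc:
  "inverse (qpoch (Suc p)) * (1 - fps_X ^ Suc p) = inverse (qpoch p)"
proof -
  have "qpoch (Suc p) = qpoch p * (1 - fps_X ^ Suc p)"
    by (simp add: qpoch_def)
  then have "inverse (qpoch (Suc p)) * (1 - fps_X ^ Suc p)
      = inverse (qpoch p) * (inverse (1 - fps_X ^ Suc p) * (1 - fps_X ^ Suc p))"
    by (simp add: fps_inverse_mult mult.assoc)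
  also have "inverse (1 - fps_X ^ Suc p :: rat fps) * (1 - fps_X ^ Suc p) = 1"
    by (rule inverse_mult_eq_1) simp
  finally show ?thesis by simp
qed

definition fermionic_coeff :: "nat \<Rightarrow> nat \<Rightarrow> nat \<Rightarrow> rat fps" where
  "fermionic_coeff k b n =
     (\<Sum>m\<in>weighted_vectors k n. fps_X ^ fermionic_exponent k b m / (\<Prod>a=1..k. qpoch (m a)))"

text \<open>The part of the exponent that depends on \<open>p\<close> = m_k alone. For b <= k it is
  k p^2 - b p, arranged as a sum of nonnegative terms; at p = 0 the truncated \<open>p - 1\<close>
  is killed by the factor \<open>p\<close>.\<close>

definition peel_exponent :: "nat \<Rightarrow> nat \<Rightarrow> nat \<Rightarrow> nat" where
  "peel_exponent k b p = (k - b) * p + k * (p * (p - 1))"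

text \<open>Since min(a, k+1) = a for a <= k, the cross terms pair \<open>p\<close> with the weight
  \<open>s\<close>. They occur twice in the quadratic form, and halving leaves 2ps, the effect of z
  -> q^(2p) z. The bound becomes \<open>min b k\<close> because b = k+1 and b = k both give zero
  linear coefficients for a <= k.\<close>

lemma fermionic_exponent_peel:
  assumes b: "b \<le> Suc k" and m: "(\<Sum>a=1..k. a * m a) = s"
  shows "fermionic_exponent (Suc k) b (m(Suc k := p))
       = fermionic_exponent k (min b k) m + peel_exponent (Suc k) b p + 2 * p * s"
proof -
  define f where "f = m(Suc k := p)"
  have f: "f (Suc k) = p" "\<And>a. a \<in> {1..k} \<Longrightarrow> f a = m a"
    by (auto simp: f_def)
  have s: "(\<Sum>a=1..k. int a * int (m a)) = int s"
    using m by (simp flip: of_nat_mult of_nat_sum)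
  define Q where "Q = (\<Sum>a=1..k. \<Sum>b=1..k. int (m a) * A2 a b * int (m b))"
  define D where "D = (\<Sum>a=1..k. A2 a a * int (m a))"
  define C where "C = (\<Sum>a=1..k. c2 (min b k) a * int (m a))"
  have row: "(\<Sum>a=1..k. int (f a) * A2 a (Suc k) * int (f (Suc k))) = 2 * int p * int s"
  proof -
    have "(\<Sum>a=1..k. int (f a) * A2 a (Suc k) * int (f (Suc k)))
        = (\<Sum>a=1..k. 2 * int p * (int a * int (m a)))"
      by (rule sum.cong) (auto simp: f A2_def min_def)
    then show ?thesis by (simp only: s flip: sum_distrib_left)
  qed
  have col: "(\<Sum>a=1..k. int (f (Suc k)) * A2 (Suc k) a * int (f a)) = 2 * int p * int s"
  proof -
    have "(\<Sum>a=1..k. int (f (Suc k)) * A2 (Suc k) a * int (f a))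
        = (\<Sum>a=1..k. 2 * int p * (int a * int (m a)))"
      by (rule sum.cong) (auto simp: f A2_def min_def)
    then show ?thesis by (simp only: s flip: sum_distrib_left)
  qed
  have "(\<Sum>a=1..Suc k. \<Sum>b=1..Suc k. int (f a) * A2 a b * int (f b))
      = (\<Sum>a=1..k. \<Sum>b=1..k. int (f a) * A2 a b * int (f b))
        + 4 * int p * int s + 2 * int (Suc k) * int p * int p"
    using row col by (simp add: sum.distrib f A2_def)
  also have "(\<Sum>a=1..k. \<Sum>b=1..k. int (f a) * A2 a b * int (f b)) = Q"
    unfolding Q_def by (intro sum.cong refl) (simp add: f)
  finally have Q: "(\<Sum>a=1..Suc k. \<Sum>b=1..Suc k. int (f a) * A2 a b * int (f b))
      = Q + 4 * int p * int s + 2 * int (Suc k) * int p * int p" .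
  have "(\<Sum>a=1..k. A2 a a * int (f a)) = D"
    unfolding D_def by (intro sum.cong refl) (simp add: f)
  then have D: "(\<Sum>a=1..Suc k. A2 a a * int (f a)) = D + 2 * int (Suc k) * int p"
    by (simp add: f A2_def)
  have "(\<Sum>a=1..k. c2 b a * int (f a)) = C"
    unfolding C_def by (intro sum.cong refl) (use b in \<open>auto simp: f c2_def min_def\<close>)
  then have C: "(\<Sum>a=1..Suc k. c2 b a * int (f a)) = C + int (Suc k - b) * int p"
    using b by (simp add: f c2_def)
  have "int (p * (p - 1)) = int p * int p - int p"
    by (cases p) (auto simp: algebra_simps)
  then have E: "int (peel_exponent (Suc k) b p)
      = int (Suc k - b) * int p + int (Suc k) * (int p * int p - int p)"
    by (simp only: peel_exponent_def of_nat_add of_nat_mult)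
  \<comment> \<open>After doubling, the exponents satisfy integer equations free of
    \<open>div\<close> and \<open>nat\<close>, so they can be compared linearly.\<close>
  have "2 * int (fermionic_exponent (Suc k) b f)
      = 2 * int (fermionic_exponent k (min b k) m + peel_exponent (Suc k) b p + 2 * p * s)"
    using int_fermionic_exponent[of "Suc k" b f] int_fermionic_exponent[of k "min b k" m]
    unfolding Q D C Q_def[symmetric] D_def[symmetric] C_def[symmetric] of_nat_add E
    by (simp add: algebra_simps)
  then have "int (fermionic_exponent (Suc k) b f)
      = int (fermionic_exponent k (min b k) m + peel_exponent (Suc k) b p + 2 * p * s)"
    by (metis mult_cancel_left zero_neq_numeral)
  then show ?thesis by (simp only: of_nat_eq_iff f_def)
qed

text \<open>The entry p = m_(k+1) takes up weight (k+1)p and leaves n - (k+1)p to the others. The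
  range p <= n with default 0 lets sums for different degrees be brought to a common range.\<close>

lemma fermionic_coeff_Suc:
  assumes b: "b \<le> Suc k"
  shows "fermionic_coeff (Suc k) b n
       = (\<Sum>p\<le>n. if Suc k * p \<le> n
            then fps_X ^ (peel_exponent (Suc k) b p + 2 * p * (n - Suc k * p))
                 * inverse (qpoch p) * fermionic_coeff k (min b k) (n - Suc k * p)
            else 0)"
proof -
  define P where "P = {p. Suc k * p \<le> n}"
  have P: "P \<subseteq> {..n}" by (auto simp: P_def)
  then have "finite P" by (rule finite_subset) simp
  define h where "h = (\<lambda>m. fps_X ^ fermionic_exponent (Suc k) b m
                           / (\<Prod>a=1..Suc k. qpoch (m a)))"
  have "fermionic_coeff (Suc k) b n
      = (\<Sum>(p, m)\<in>(SIGMA p:P. weighted_vectors k (n - Suc k * p)). h (m(Suc k := p)))"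
    unfolding fermionic_coeff_def h_def[symmetric]
  \<comment> \<open>Entry \<open>Suc k\<close> is reset to \<open>undefined\<close> because the
    shorter vectors are extensional on \<open>{1..k}\<close>.\<close>
  proof (rule sum.reindex_bij_witness
      [where i = "\<lambda>(p, m). m(Suc k := p)" and j = "\<lambda>m. (m (Suc k), m(Suc k := undefined))"],
      goal_cases)
    case (2 m)
    then have "Suc k * m (Suc k) + (\<Sum>a=1..k. a * m a) = n"
      by (simp add: weighted_vectors_def)
    moreover have "(\<Sum>a=1..k. a * (m(Suc k := undefined)) a) = (\<Sum>a=1..k. a * m a)"
      by (rule sum.cong) auto
    ultimately show ?case using 2
      by (auto simp: weighted_vectors_def P_def PiE_def extensional_def)
  next
    case (4 x)
    obtain p m where x: "x = (p, m)" by (cases x)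
    have "(\<Sum>a=1..k. a * (m(Suc k := p)) a) = (\<Sum>a=1..k. a * m a)"
      by (rule sum.cong) auto
    then show ?case using 4
      by (auto simp: x weighted_vectors_def P_def PiE_def extensional_def)
  qed (auto simp: weighted_vectors_def PiE_def extensional_def fun_eq_iff)
  also have "\<dots> = (\<Sum>p\<in>P. \<Sum>m\<in>weighted_vectors k (n - Suc k * p). h (m(Suc k := p)))"
    using \<open>finite P\<close> by (simp add: sum.Sigma finite_weighted_vectors)
  also have "\<dots> = (\<Sum>p\<in>P. fps_X ^ (peel_exponent (Suc k) b p + 2 * p * (n - Suc k * p))
                 * inverse (qpoch p) * fermionic_coeff k (min b k) (n - Suc k * p))"
  proof (rule sum.cong[OF refl])
    fix p
    have "h (m(Suc k := p)) = fps_X ^ (peel_exponent (Suc k) b p + 2 * p * (n - Suc k * p))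
        * inverse (qpoch p) * (fps_X ^ fermionic_exponent k (min b k) m
                               / (\<Prod>a=1..k. qpoch (m a)))"
      if m: "m \<in> weighted_vectors k (n - Suc k * p)" for m
    proof -
      have "(\<Prod>a=1..k. qpoch ((m(Suc k := p)) a)) = (\<Prod>a=1..k. qpoch (m a))"
        by (rule prod.cong) auto
      then have pr: "(\<Prod>a=1..Suc k. qpoch ((m(Suc k := p)) a))
          = (\<Prod>a=1..k. qpoch (m a)) * qpoch p"
        by simp
      have nz: "(\<Prod>a=1..k. qpoch (m a)) $ 0 \<noteq> 0"
        by (induction k) (simp_all add: qpoch_nth_0)
      have ex: "fermionic_exponent (Suc k) b (m(Suc k := p))
          = fermionic_exponent k (min b k) m + peel_exponent (Suc k) b p
            + 2 * p * (n - Suc k * p)"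
        using m by (intro fermionic_exponent_peel b) (simp add: weighted_vectors_def)
      show ?thesis
        unfolding h_def pr ex using nz
        by (simp add: fps_divide_unit qpoch_nth_0 fps_inverse_mult power_add mult_ac)
    qed
    then show "(\<Sum>m\<in>weighted_vectors k (n - Suc k * p). h (m(Suc k := p)))
        = fps_X ^ (peel_exponent (Suc k) b p + 2 * p * (n - Suc k * p))
                 * inverse (qpoch p) * fermionic_coeff k (min b k) (n - Suc k * p)"
      by (simp add: fermionic_coeff_def sum_distrib_left)
  qed
  also have "\<dots> = (\<Sum>p\<le>n. if Suc k * p \<le> n
            then fps_X ^ (peel_exponent (Suc k) b p + 2 * p * (n - Suc k * p))
                 * inverse (qpoch p) * fermionic_coeff k (min b k) (n - Suc k * p)
            else 0)"
    using P by (intro sum.mono_neutral_cong_left) (auto simp: P_def)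
  finally show ?thesis .
qed

lemma fermionic_coeff_0_right: "b \<le> k \<Longrightarrow> fermionic_coeff k b 0 = 1"
proof (induction k arbitrary: b)
  case 0
  show ?case
    by (simp add: fermionic_coeff_def weighted_vectors_def fermionic_exponent_def)
next
  case (Suc k)
  then show ?case
    by (simp add: fermionic_coeff_Suc peel_exponent_def qpoch_def)
qed

section \<open>Uniqueness of the solution of the recursion\<close>

text \<open>
  The relations on coefficients of \<open>z\<^sup>n\<close>: replacing \<open>z\<close> by \<open>qz\<close> becomes
  multiplication by \<open>q\<^sup>n\<close>.
\<close>

definition admissible_recursion :: "nat \<Rightarrow> (nat \<Rightarrow> nat \<Rightarrow> rat fps) \<Rightarrow> bool" where
  "admissible_recursion k g \<longleftrightarrow>
     (\<forall>b\<le>k. g b 0 = 1) \<and>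
     (\<forall>n. g 0 n = fps_X ^ n * g k n) \<and>
     (\<forall>b n. b < k \<longrightarrow> g (Suc b) n = g b n +
        (if Suc b \<le> n then fps_X ^ (n - Suc b) * g (k - Suc b) (n - Suc b) else 0))"

text \<open>For n > 0 the differences \<open>g b n - g 0 n\<close> involve only smaller degrees.
  With b = k, the relation \<open>g 0 n = fps_X ^ n * g k n\<close> then fixes (1 - q^n)
  \<open>g k n\<close>, and the factor 1 - q^n can be cancelled.\<close>

lemma admissible_recursion_unique:
  assumes f: "admissible_recursion k f" and g: "admissible_recursion k g" and "b \<le> k"
  shows "f b n = g b n"
  using \<open>b \<le> k\<close>
proof (induction n arbitrary: b rule: less_induct)
  case (less n)
  show ?case
  proof (cases "n = 0")
    case True
    then show ?thesis using f g less.prems by (simp add: admissible_recursion_def)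
  next
    case False
    have diff: "f b n - f 0 n = g b n - g 0 n" if "b \<le> k" for b
      using that
    proof (induction b)
      case (Suc b)
      then have "f (k - Suc b) (n - Suc b) = g (k - Suc b) (n - Suc b)"
        using False by (intro less.IH) auto
      then show ?case using Suc f g by (auto simp: admissible_recursion_def algebra_simps)
    qed simp
    have "f 0 n = fps_X ^ n * f k n" "g 0 n = fps_X ^ n * g k n"
      using f g by (auto simp: admissible_recursion_def)
    with diff[of k] have "(1 - fps_X ^ n) * f k n = (1 - fps_X ^ n) * g k n"
      by (simp add: algebra_simps)
    moreover have "(1 - fps_X ^ n :: rat fps) $ 0 \<noteq> 0"
      using False by simp
    then have "(1 - fps_X ^ n :: rat fps) \<noteq> 0" by (metis fps_zero_nth)
    ultimately have "f k n = g k n" by simp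
    then have "f 0 n = g 0 n"
      using f g by (simp add: admissible_recursion_def)
    with diff[OF less.prems] show ?thesis by simp
  qed
qed

section \<open>The recursion for the fermionic side\<close>

text \<open>(1 - q^p)/(q)_p equals 1/(q)_(p-1) for p > 0 and vanishes for p = 0, so the index moves
  down by one; the vanishing of \<open>u (Suc n)\<close> keeps the range unchanged.\<close>

lemma sum_inverse_qpoch_shift:
  fixes u :: "nat \<Rightarrow> rat fps"
  assumes "u (Suc n) = 0"
  shows "(\<Sum>p\<le>n. (1 - fps_X ^ p) * inverse (qpoch p) * u p)
       = (\<Sum>p\<le>n. inverse (qpoch p) * u (Suc p))"
proof -
  have "(\<Sum>p\<le>n. (1 - fps_X ^ p) * inverse (qpoch p) * u p)
      = (\<Sum>p\<le>Suc n. (1 - fps_X ^ p) * inverse (qpoch p) * u p)"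
    using assms by simp
  also have "\<dots> = (\<Sum>p\<le>n. (1 - fps_X ^ Suc p) * inverse (qpoch (Suc p)) * u (Suc p))"
    by (subst sum.atMost_Suc_shift) simp
  also have "\<dots> = (\<Sum>p\<le>n. inverse (qpoch p) * u (Suc p))"
    by (subst inverse_qpoch_Suc[symmetric]) (simp add: mult_ac)
  finally show ?thesis .
qed

lemma peel_exponent_Suc_right:
  "b < k \<Longrightarrow> peel_exponent k b p = peel_exponent k (Suc b) p + p"
  by (auto simp: peel_exponent_def Suc_diff_Suc[symmetric] simp del: Suc_diff_Suc)

text \<open>Exponent bookkeeping for terms whose index \<open>p\<close> is unchanged when G_(k,b) is
  compared with q^(n-b) G_(k,k-b) in degree n - b. Writing k = b + c and n = kp + b + r removes the
  truncated subtractions.\<close>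

lemma peel_exponent_reflect:
  assumes "b \<le> k" "k * p + b \<le> n"
  shows "peel_exponent k b p + 2 * p * (n - k * p) + (n - k * p - b)
       = (n - b) + peel_exponent k (k - b) p + 2 * p * (n - b - k * p)"
proof -
  obtain c where k: "k = b + c" using assms(1) le_Suc_ex by blast
  obtain r where n: "n = k * p + b + r" using assms(2) le_Suc_ex by blast
  have "n - k * p = b + r" "n - k * p - b = r" "n - b = k * p + r" "n - b - k * p = r"
    by (auto simp: n)
  then show ?thesis by (simp add: peel_exponent_def k algebra_simps)
qed

text \<open>The counterpart for terms whose index moves from \<open>p\<close> to
  \<open>Suc p\<close>; the summand \<open>n - k * Suc p\<close> is the power of q supplied by the
  recursion one level below.\<close>

lemma peel_exponent_shift:
  assumes "b \<le> k" "k * Suc p \<le> n"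
  shows "(n - b) + peel_exponent k (k - b) p + 2 * p * (n - b - k * p) + (n - k * Suc p)
       = peel_exponent k b (Suc p) + 2 * Suc p * (n - k * Suc p)"
proof -
  obtain c where k: "k = b + c" using assms(1) le_Suc_ex by blast
  obtain r where n: "n = k * Suc p + r" using assms(2) le_Suc_ex by blast
  have "n - b = k * p + c + r" "n - k * Suc p = r" "n - b - k * p = c + r"
    by (auto simp: n k)
  then show ?thesis by (cases p) (simp_all add: peel_exponent_def k algebra_simps)
qed

text \<open>In G_(b+1) - G_b the p-th terms differ by a factor q^p and by the level-k relation,
  giving (1 - q^p) u(p) + v(p) over (q)_p. Shifting the index turns this into u(p+1) + v(p) over
  (q)_p, and the level-k relation at the reflected index k - b merges the two into one term of the
  required sum.\<close>

lemma admissible_recursion_fermionic: "admissible_recursion k (fermionic_coeff k)"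
proof (induction k)
  case 0
  have "fermionic_coeff 0 0 n = 0" if "n > 0" for n
    using that by (simp add: fermionic_coeff_def weighted_vectors_def)
  then have "fermionic_coeff 0 0 n = fps_X ^ n * fermionic_coeff 0 0 n" for n
    by (cases "n = 0") auto
  then show ?case by (simp add: admissible_recursion_def fermionic_coeff_0_right)
next
  case (Suc k)
  let ?g = "fermionic_coeff k" and ?G = "fermionic_coeff (Suc k)"
  let ?K = "Suc k" and ?E = "peel_exponent (Suc k)" and ?w = "\<lambda>p. inverse (qpoch p)"
  let ?X = "fps_X :: rat fps"
  have g0: "?g 0 n = ?X ^ n * ?g k n" for n
    using Suc by (simp add: admissible_recursion_def)
  have gS: "?g (Suc b) n = ?g b n
        + (if Suc b \<le> n then ?X ^ (n - Suc b) * ?g (k - Suc b) (n - Suc b) else 0)"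
    if "b < k" for b n
    using Suc that by (simp add: admissible_recursion_def)

  \<comment> \<open>Termwise: lowering the bound from \<open>?K\<close> to 0 adds
    \<open>?K * p\<close> to the peeled exponent, and the level-k relation adds
    \<open>n - ?K * p\<close>, in total n.\<close>
  have "?G 0 n = ?X ^ n * ?G ?K n" for n
  proof -
    have "?X ^ (?E 0 p + 2 * p * (n - ?K * p)) * ?w p * ?g 0 (n - ?K * p)
        = ?X ^ n * (?X ^ (?E ?K p + 2 * p * (n - ?K * p)) * ?w p * ?g k (n - ?K * p))"
      if p: "?K * p \<le> n" for p
    proof -
      have "?E 0 p + 2 * p * (n - ?K * p) + (n - ?K * p) = n + (?E ?K p + 2 * p * (n - ?K * p))"
        using p by (simp add: peel_exponent_def)
      then have "?X ^ (?E 0 p + 2 * p * (n - ?K * p)) * ?X ^ (n - ?K * p)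
          = ?X ^ n * ?X ^ (?E ?K p + 2 * p * (n - ?K * p))" (is "?a * ?b = _ * ?c")
        by (simp only: power_add[symmetric])
      then have "?a * ?b * (?w p * ?g k (n - ?K * p)) = ?X ^ n * ?c * (?w p * ?g k (n - ?K * p))"
        by (rule arg_cong)
      then show ?thesis unfolding g0 by (simp only: mult.assoc mult.left_commute[of "?w p"])
    qed
    then show ?thesis
      unfolding fermionic_coeff_Suc[OF le0] fermionic_coeff_Suc[OF le_refl] sum_distrib_left
      by (intro sum.cong) auto
  qed

  moreover have "?G (Suc b) n = ?G b n
        + (if Suc b \<le> n then ?X ^ (n - Suc b) * ?G (?K - Suc b) (n - Suc b) else 0)"
    if b: "b < ?K" for b n
  proof -
    \<comment> \<open>\<open>u\<close> is the part common to both p-th terms, \<open>v\<close> the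
      increment from \<open>?g b\<close> to \<open>?g (Suc b)\<close>. For b = k both bounds are cut
      to k by \<open>min\<close>, so \<open>v\<close> is 0.\<close>
    define u where "u = (\<lambda>p. if ?K * p \<le> n
        then ?X ^ (?E (Suc b) p + 2 * p * (n - ?K * p)) * ?g b (n - ?K * p) else 0)"
    define v where "v = (\<lambda>p. if Suc b \<le> k \<and> ?K * p + Suc b \<le> n
        then ?X ^ (?E (Suc b) p + 2 * p * (n - ?K * p) + (n - ?K * p - Suc b))
             * ?g (k - Suc b) (n - ?K * p - Suc b) else 0)"
    have "?G (Suc b) n - ?G b n = (\<Sum>p\<le>n. (1 - ?X ^ p) * ?w p * u p + ?w p * v p)"
      unfolding fermionic_coeff_Suc[OF less_imp_le[OF b]]
        fermionic_coeff_Suc[OF Suc_leI[OF b]] sum_subtractf[symmetric]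
    proof (rule sum.cong[OF refl], goal_cases)
      case (1 p)
      show ?case
      proof (cases "?K * p \<le> n")
        case False
        then show ?thesis by (auto simp: u_def v_def)
      next
        case True
        define r where "r = n - ?K * p"
        define Y where "Y = ?X ^ (?E (Suc b) p + 2 * p * r)"
        have "?K * p + Suc b \<le> n \<longleftrightarrow> Suc b \<le> r"
          using True by (auto simp: r_def)
        then have v: "v p = (if Suc b \<le> k \<and> Suc b \<le> r
            then Y * ?X ^ (r - Suc b) * ?g (k - Suc b) (r - Suc b) else 0)"
          by (simp only: v_def Y_def r_def[symmetric] power_add)
        have u: "u p = Y * ?g b r"
          using True by (simp only: u_def Y_def r_def if_True)
        have Y: "?X ^ (?E b p + 2 * p * r) = ?X ^ p * Y"
          by (simp add: Y_def peel_exponent_Suc_right[OF b] power_add mult_ac)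
        have "min b k = b" using b by simp
        then have "Y * ?w p * ?g (min (Suc b) k) r - ?X ^ p * Y * ?w p * ?g (min b k) r
            = (1 - ?X ^ p) * ?w p * u p + ?w p * v p"
        proof (cases "Suc b \<le> k")
          case True
          then show ?thesis using \<open>min b k = b\<close> gS[of b r]
            by (simp add: u v algebra_simps)
        next
          case False
          then have "b = k" using b by simp
          then show ?thesis by (simp add: u v algebra_simps)
        qed
        then show ?thesis
          using True by (simp only: r_def[symmetric] Y Y_def[symmetric] if_True)
      qed
    qed
    also have "\<dots> = (\<Sum>p\<le>n. ?w p * (u (Suc p) + v p))"
      using sum_inverse_qpoch_shift[of u n] by (simp add: u_def sum.distrib distrib_left)
    also have "\<dots> = (if Suc b \<le> n then ?X ^ (n - Suc b) * ?G (?K - Suc b) (n - Suc b) else 0)"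
    proof (cases "Suc b \<le> n")
      case False
      then have "u (Suc p) = 0" "v p = 0" for p
        using b by (auto simp: u_def v_def)
      with False show ?thesis by simp
    next
      case True
      \<comment> \<open>Up to 1/(q)_p, the p-th term of the target; \<open>?g (k - b)\<close>
        appears because \<open>?K - Suc b\<close> is k - b.\<close>
      define t where "t = (\<lambda>p. if ?K * p \<le> n - Suc b
          then ?X ^ ((n - Suc b) + ?E (?K - Suc b) p + 2 * p * (n - Suc b - ?K * p))
               * ?g (k - b) (n - Suc b - ?K * p) else 0)"
      have t: "t p = u (Suc p) + v p" for p
      proof (cases "?K * p + Suc b \<le> n")
        case False
        then show ?thesis using b True by (auto simp: t_def u_def v_def)
      next
        case le: True
        let ?r = "n - Suc b - ?K * p"
        have r: "n - ?K * p - Suc b = ?r" by simp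
        \<comment> \<open>For b < k this is the step from k - b - 1 to k - b one level below; for b
          = k it is the relation expressing \<open>?g 0\<close> through \<open>?g k\<close>.\<close>
        have gkb: "?g (k - b) ?r
            = (if Suc b \<le> k then ?g (k - Suc b) ?r else 0)
              + (if ?K * Suc p \<le> n then ?X ^ (n - ?K * Suc p) * ?g b (n - ?K * Suc p) else 0)"
        proof (cases "Suc b \<le> k")
          case True
          then have "Suc (k - Suc b) = k - b" "k - (k - b) = b" by auto
          moreover have "k - b \<le> ?r \<longleftrightarrow> ?K * Suc p \<le> n" "?r - (k - b) = n - ?K * Suc p"
            using le True by auto
          ultimately show ?thesis using True gS[of "k - Suc b" ?r] by simp
        next
          case False
          then have "b = k" using b by simp
          moreover have "?r = n - ?K * Suc p" "?K * Suc p \<le> n" using le \<open>b = k\<close> by auto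
          ultimately show ?thesis using g0[of ?r] by simp
        qed
        define Z where "Z = ?X ^ ((n - Suc b) + ?E (?K - Suc b) p + 2 * p * ?r)"
        have "t p = Z * ?g (k - b) ?r"
          using le by (simp add: t_def Z_def)
        moreover have "u (Suc p) = (if ?K * Suc p \<le> n
            then Z * ?X ^ (n - ?K * Suc p) * ?g b (n - ?K * Suc p) else 0)"
        proof (cases "?K * Suc p \<le> n")
          case True
          then show ?thesis
            unfolding u_def Z_def power_add[symmetric] peel_exponent_shift[OF Suc_leI[OF b] True]
            by (simp only: if_True)
        qed (simp only: u_def if_False)
        moreover have "v p = (if Suc b \<le> k then Z * ?g (k - Suc b) ?r else 0)"
          unfolding v_def Z_def r peel_exponent_reflect[OF Suc_leI[OF b] le, unfolded r]
          by (simp only: le simp_thms)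
        ultimately show ?thesis
          unfolding gkb by (simp only: mult.assoc distrib_left mult_zero_right add.commute
              if_distrib[of "(*) Z"])
      qed
      have "?X ^ (n - Suc b) * ?G (?K - Suc b) (n - Suc b) = (\<Sum>p\<le>n - Suc b. ?w p * t p)"
        unfolding fermionic_coeff_Suc[OF diff_le_self] sum_distrib_left
        by (intro sum.cong) (auto simp: t_def power_add mult_ac)
      also have "\<dots> = (\<Sum>p\<le>n. ?w p * t p)"
        by (rule sum.mono_neutral_left) (auto simp: t_def)
      finally show ?thesis using True by (simp add: t)
    qed
    finally show ?thesis by (simp add: algebra_simps)
  qed
  ultimately show ?case
    by (simp add: admissible_recursion_def fermionic_coeff_0_right)
qed

section \<open>The recursion for the character\<close>

definition graded_configs :: "nat \<Rightarrow> nat \<Rightarrow> nat \<Rightarrow> nat \<Rightarrow> (nat \<Rightarrow> nat) set" where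
  "graded_configs k b n e = {a \<in> configs2 k b. zdegree a = n \<and> qdegree a = e}"

lemma character2_nth: "character2 k b $ n $ e = of_nat (card (graded_configs k b n e))"
proof -
  have "{a \<in> configs2 k b. (qvar ^ qdegree a * zvar ^ zdegree a) $ n $ e \<noteq> 0}
      = graded_configs k b n e"
    by (auto simp: graded_configs_def monomial_nth)
  moreover have "(\<Sum>a\<in>graded_configs k b n e. (qvar ^ qdegree a * zvar ^ zdegree a) $ n $ e)
      = (\<Sum>a\<in>graded_configs k b n e. 1)"
    by (rule sum.cong) (auto simp: graded_configs_def monomial_nth)
  ultimately show ?thesis by (simp add: character2_def formal_sum_def)
qed

lemma finite_graded_configs: "finite (graded_configs k b n e)"
proof -
  have "graded_configs k b n e
      = {a \<in> configs2 k b. (qvar ^ qdegree a * zvar ^ zdegree a) $ n $ e \<noteq> 0}"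
    by (auto simp: graded_configs_def monomial_nth)
  then show ?thesis
    using formally_summable_character2 by (simp add: formally_summable_def)
qed

lemma case_nat_support:
  "{j. case_nat c a j \<noteq> 0} = (if c = 0 then {} else {0}) \<union> Suc ` {j. a j \<noteq> 0}"
proof -
  have "j \<in> {j. case_nat c a j \<noteq> 0} \<longleftrightarrow> j \<in> (if c = 0 then {} else {0}) \<union> Suc ` {j. a j \<noteq> 0}" for j
    by (cases j) auto
  then show ?thesis by blast
qed

text \<open>Prepending an entry moves every other entry one place to the right, which raises the
  q-degree by the sum of those entries. This is the source of z -> qz.\<close>

lemma degree_case_nat:
  assumes "finite {j. a j \<noteq> 0}"
  shows "zdegree (case_nat c a) = c + zdegree a"
    and "qdegree (case_nat c a) = zdegree a + qdegree a"
proof -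
  have "zdegree (case_nat c a) = c + (\<Sum>j\<in>Suc ` {j. a j \<noteq> 0}. case_nat c a j)"
    unfolding zdegree_def case_nat_support using assms
    by (subst sum.union_disjoint) auto
  also have "\<dots> = c + zdegree a"
    by (simp add: sum.reindex zdegree_def)
  finally show "zdegree (case_nat c a) = c + zdegree a" .
  have "qdegree (case_nat c a) = (\<Sum>j\<in>Suc ` {j. a j \<noteq> 0}. j * case_nat c a j)"
    unfolding qdegree_def case_nat_support using assms
    by (subst sum.union_disjoint) auto
  also have "\<dots> = zdegree a + qdegree a"
    by (simp add: sum.reindex zdegree_def qdegree_def sum.distrib)
  finally show "qdegree (case_nat c a) = zdegree a + qdegree a" .
qed

text \<open>The only condition linking the new entry to the tail is c + a_0 <= k, which turns into
  the initial bound k - c on the tail.\<close>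

lemma admissible2_case_nat:
  "admissible2 k (case_nat c a) \<longleftrightarrow> c \<le> k \<and> admissible2 k a \<and> a 0 \<le> k - c"
proof -
  have all_nat: "(\<forall>i. P i) \<longleftrightarrow> P 0 \<and> (\<forall>i. P (Suc i))" for P
    by (metis nat.exhaust)
  have "finite {j. case_nat c a j \<noteq> 0} \<longleftrightarrow> finite {j. a j \<noteq> 0}"
    unfolding case_nat_support by (auto simp: finite_image_iff)
  moreover have "(\<forall>i. case_nat c a i \<le> k) \<longleftrightarrow> c \<le> k \<and> (\<forall>i. a i \<le> k)"
    by (subst all_nat) simp
  moreover have "(\<forall>i. case_nat c a i + case_nat c a (i + 1) \<le> k)
      \<longleftrightarrow> c + a 0 \<le> k \<and> (\<forall>i. a i + a (i + 1) \<le> k)"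
    by (subst all_nat) simp
  ultimately show ?thesis
    unfolding admissible2_def by auto
qed

lemma graded_configs_first_entry:
  assumes "c \<le> b" "b \<le> k"
  shows "{a \<in> graded_configs k b n e. a 0 = c}
       = (if c \<le> n \<and> n - c \<le> e
          then case_nat c ` graded_configs k (k - c) (n - c) (e - (n - c)) else {})"
proof -
  have "a \<in> graded_configs k b n e \<and> a 0 = c \<longleftrightarrow>
      c \<le> n \<and> n - c \<le> e \<and> a \<in> case_nat c ` graded_configs k (k - c) (n - c) (e - (n - c))"
    (is "?L \<longleftrightarrow> ?R") for a
  proof -
    define t where "t = (\<lambda>j. a (Suc j))"
    have split: "case_nat (a 0) t = a"
      by (auto simp: t_def fun_eq_iff split: nat.splits)
    have "?R \<longleftrightarrow> a 0 = c \<and> c \<le> n \<and> n - c \<le> e \<and> t \<in> graded_configs k (k - c) (n - c) (e - (n - c))"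
    proof -
      have "a \<in> case_nat c ` S \<longleftrightarrow> a 0 = c \<and> t \<in> S" for S
      proof
        assume "a \<in> case_nat c ` S"
        then obtain s where "a = case_nat c s" "s \<in> S" by blast
        then show "a 0 = c \<and> t \<in> S" by (simp add: t_def)
      next
        assume "a 0 = c \<and> t \<in> S"
        then show "a \<in> case_nat c ` S" using split by (metis image_eqI)
      qed
      then show ?thesis by blast
    qed
    moreover have "case_nat c t \<in> graded_configs k b n e \<longleftrightarrow>
        c \<le> n \<and> n - c \<le> e \<and> t \<in> graded_configs k (k - c) (n - c) (e - (n - c))"
    \<comment> \<open>The degree formulas require finite support, which admissibility supplies; for
      an inadmissible tail both sides are false.\<close>
    proof (cases "admissible2 k t")
      case True
      then have "finite {j. t j \<noteq> 0}" by (simp add: admissible2_def)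
      note deg = degree_case_nat[OF this]
      show ?thesis
        unfolding graded_configs_def configs2_def mem_Collect_eq deg admissible2_case_nat
        using assms by auto
    next
      case False
      then show ?thesis
        by (simp add: graded_configs_def configs2_def admissible2_case_nat)
    qed
    ultimately show ?thesis using split by metis
  qed
  then show ?thesis by auto
qed

lemma card_graded_configs_first_entry:
  assumes "c \<le> b" "b \<le> k"
  shows "of_nat (card {a \<in> graded_configs k b n e. a 0 = c})
       = (if c \<le> n then fps_X ^ (n - c) * character2 k (k - c) $ (n - c) else 0) $ e"
proof -
  have "inj (case_nat c :: (nat \<Rightarrow> nat) \<Rightarrow> _)"
    by (rule injI) (metis nat.case(2) ext)
  then show ?thesis
    by (simp add: graded_configs_first_entry[OF assms] character2_nth fps_X_power_mult_nth
        card_image inj_on_subset)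
qed

lemma character2_nth_0:
  assumes "b \<le> k"
  shows "character2 k b $ 0 = 1"
proof -
  have "graded_configs k b 0 e = (if e = 0 then {\<lambda>_. 0} else {})" for e
  proof -
    have "a = (\<lambda>_. 0)" if "a \<in> graded_configs k b 0 e" for a
      using that by (auto simp: graded_configs_def configs2_def admissible2_def zdegree_def)
    moreover have "(\<lambda>_. 0) \<in> graded_configs k b 0 e \<longleftrightarrow> e = 0"
      by (auto simp: graded_configs_def configs2_def admissible2_def zdegree_def qdegree_def)
    ultimately show ?thesis by auto
  qed
  then show ?thesis by (simp add: fps_eq_iff character2_nth)
qed

text \<open>Bound 0 forces the first entry to be 0 and leaves a tail with bound k. Raising the bound
  from b to b+1 adds exactly the configurations starting with b+1, whose tails have bound k - b -
  1.\<close>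

lemma admissible_recursion_character2: "admissible_recursion k (\<lambda>b n. character2 k b $ n)"
proof -
  have "character2 k 0 $ n = fps_X ^ n * character2 k k $ n" for n
  proof (rule fps_ext)
    fix e
    have "graded_configs k 0 n e = {a \<in> graded_configs k 0 n e. a 0 = 0}"
      by (auto simp: graded_configs_def configs2_def)
    then show "character2 k 0 $ n $ e = (fps_X ^ n * character2 k k $ n) $ e"
      using card_graded_configs_first_entry[of 0 0 k n e] by (simp add: character2_nth)
  qed
  moreover have "character2 k (Suc b) $ n = character2 k b $ n
      + (if Suc b \<le> n then fps_X ^ (n - Suc b) * character2 k (k - Suc b) $ (n - Suc b) else 0)"
    if "b < k" for b n
  proof (rule fps_ext)
    fix e
    have "graded_configs k (Suc b) n e
        = graded_configs k b n e \<union> {a \<in> graded_configs k (Suc b) n e. a 0 = Suc b}"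
      by (auto simp: graded_configs_def configs2_def)
    moreover have "graded_configs k b n e \<inter> {a \<in> graded_configs k (Suc b) n e. a 0 = Suc b} = {}"
      by (auto simp: graded_configs_def configs2_def)
    ultimately have "card (graded_configs k (Suc b) n e) = card (graded_configs k b n e)
        + card {a \<in> graded_configs k (Suc b) n e. a 0 = Suc b}"
      by (metis card_Un_disjoint finite_Un finite_graded_configs)
    then show "character2 k (Suc b) $ n $ e = (character2 k b $ n
      + (if Suc b \<le> n then fps_X ^ (n - Suc b) * character2 k (k - Suc b) $ (n - Suc b) else 0)) $ e"
      using card_graded_configs_first_entry[of "Suc b" "Suc b" k n e] that
      by (simp only: character2_nth fps_add_nth of_nat_add)
  qed
  ultimately show ?thesis
    by (simp add: admissible_recursion_def character2_nth_0)
qed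

section \<open>Comparison of the two sides, degree by degree in z\<close>

theorem theorem7p1:
  fixes k b0 :: nat
  assumes "1 \<le> k" and "b0 \<le> k"
  shows "(\<lambda>n. fps_const (\<Sum>m\<in>weighted_vectors k n.
              fps_X ^ fermionic_exponent k b0 m / (\<Prod>a=1..k. qpoch (m a))) * zvar ^ n)
         sums character2 k b0"
proof -
  have "(\<Sum>m\<in>weighted_vectors k n.
              fps_X ^ fermionic_exponent k b0 m / (\<Prod>a=1..k. qpoch (m a))) = character2 k b0 $ n" for n
    using admissible_recursion_unique[OF admissible_recursion_fermionic
        admissible_recursion_character2 assms(2)]
    by (simp add: fermionic_coeff_def)
  \<comment> \<open>A series is the z-adic limit of its partial sums, so equality of the
    coefficients of z^n suffices.\<close>
  then show ?thesis
    unfolding sums_def' zvar_def using fps_notation[of "character2 k b0"] by simp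
qed

end
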